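(* Let $Q$ be the misère quotient of the single-theater escalation game with escalation set $S=\{1,2\}$, let $a\in Q$ be the class of a single heap of size one and $b\in Q$ the class of a single heap of size two. Then $Q$ is the commutative monoid $$Q=\langle\, a,b \mid a^2=1,\ b^3=b\,\rangle$$ (presented as a commutative monoid), which has order six, with elements $\{1,a,b,ab,b^2,ab^2\}$, and the loss set (the set of classes of misère $\mathcal{P}$-positions) is $\mathcal{P}=\{a,b^2\}$.
   Context: Heaps and moves: a position of the single-theater game with $S=\{1,2\}$ is a heap of size $r\in\mathbb{Z}_{\ge0}$; a move subtracts $d\in\{1,2\}$ with $d\le r$. Let $\mathcal{A}$ be the commutative monoid of all finite disjunctive sums of such heaps (heaps of arbitrary nonnegative sizes; the operation is disjunctive sum, the identity is the empty sum). In a sum, the player to move chooses exactly one heap of size at least $1$ and makes one legal move in it; two players alternate. Misère outcomes: the player who makes the last move (so that all heaps become $0$) loses. Thus a sum in which all heaps have size $0$ (including the empty sum) is an $\mathcal{N}$-position. Any other sum is a $\mathcal{P}$-position if and only if every sum reachable by one legal move is an $\mathcal{N}$-position, and an $\mathcal{N}$-position if and only if some sum reachable by one legal move is a $\mathcal{P}$-position. Misère quotient: for $X,Y\in\mathcal{A}$ put $X\equiv Y$ if for every $Z\in\mathcal{A}$ the sums $X+Z$ and $Y+Z$ have the same misère outcome. This is a congruence on $\mathcal{A}$. The misère quotient is the commutative monoid $Q=\mathcal{A}/{\equiv}$, written multiplicatively with identity $1$ the class of the empty sum, together with the loss set $\mathcal{P}\subseteq Q$ consisting of the classes of sums that are misère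 $\mathcal{P}$-positions. *)

theory Defs
  imports "HOL-Library.Multiset" "HOL-Algebra.Coset"
begin

definition monoid_congruence :: "('m::comm_monoid_add \<times> 'm) set \<Rightarrow> bool" where
  "monoid_congruence E \<longleftrightarrow>
     equiv UNIV E \<and> (\<forall>x y z. (x, y) \<in> E \<longrightarrow> (x + z, y + z) \<in> E)"

text \<open>The quotient is written multiplicatively although the underlying monoid is additive.\<close>

definition quotient_monoid :: "('m::comm_monoid_add \<times> 'm) set \<Rightarrow> 'm set monoid" where
  "quotient_monoid E =
     \<lparr>carrier = UNIV // E,
      mult = (\<lambda>A B. \<Union>x\<in>A. \<Union>y\<in>B. E `` {x + y}),
      one = E `` {0}\<rparr>"

definition generated_congruence :: "('m::comm_monoid_add \<times> 'm) set \<Rightarrow> ('m \<times> 'm) set" where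
  "generated_congruence R = \<Inter>{E. monoid_congruence E \<and> R \<subseteq> E}"

text \<open>\<^typ>\<open>'g multiset\<close> is the free commutative monoid on \<^typ>\<open>'g\<close>, so a relation
  between monomials is a pair of multisets of generators.\<close>

definition presented_comm_monoid ::
    "('g multiset \<times> 'g multiset) set \<Rightarrow> 'g multiset set monoid" where
  "presented_comm_monoid R = quotient_monoid (generated_congruence R)"

definition presented_generator ::
    "('g multiset \<times> 'g multiset) set \<Rightarrow> 'g \<Rightarrow> 'g multiset set" where
  "presented_generator R g = generated_congruence R `` {{#g#}}"

datatype generator = gen_a | gen_b

definition relations_ab :: "(generator multiset \<times> generator multiset) set" where
  "relations_ab = {({#gen_a, gen_a#}, {#}), ({#gen_b, gen_b, gen_b#}, {#gen_b#})}"

text \<open>A disjunctive sum of heaps is the multiset of its heap sizes. Heaps of size 0 are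
  kept as summands, so \<^term>\<open>{#0::nat#}\<close> and \<^term>\<open>{#} :: nat multiset\<close> are different sums.\<close>

type_synonym heap_sum = "nat multiset"

definition escalation_set :: "nat set" where
  "escalation_set = {1, 2}"

definition followers :: "heap_sum \<Rightarrow> heap_sum set" where
  "followers X = {add_mset (r - d) Z | r d Z.
                  X = add_mset r Z \<and> d \<in> escalation_set \<and> d \<le> r}"

lemma followers_sum_mset_less:
  assumes "Y \<in> followers X"
  shows "\<Sum>\<^sub># Y < \<Sum>\<^sub># X"
  using assms by (auto simp: followers_def escalation_set_def)

datatype outcome = N_position | P_position

function misere_outcome :: "heap_sum \<Rightarrow> outcome" where
  "misere_outcome X =
     (if \<forall>r\<in>#X. r = 0 then N_position
      else if \<forall>Y\<in>followers X. misere_outcome Y = N_position then P_position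
      else N_position)"
  by auto
termination
  by (relation "measure sum_mset") (auto simp: followers_sum_mset_less)

declare misere_outcome.simps [simp del]

definition misere_equiv :: "(heap_sum \<times> heap_sum) set" where
  "misere_equiv = {(X, Y). \<forall>Z. misere_outcome (X + Z) = misere_outcome (Y + Z)}"

lemma monoid_congruence_misere_equiv: "monoid_congruence misere_equiv"
  by (auto simp: monoid_congruence_def misere_equiv_def equiv_def refl_on_def sym_def trans_def
      add.assoc)

definition misere_quotient :: "heap_sum set monoid" where
  "misere_quotient = quotient_monoid misere_equiv"

definition misere_class :: "heap_sum \<Rightarrow> heap_sum set" where
  "misere_class X = misere_equiv `` {X}"

definition loss_set :: "heap_sum set set" where
  "loss_set = {misere_class X | X. misere_outcome X = P_position}"

end

theory Submission
  imports Defs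
begin

text \<open>
  Modulo 3, a heap of size \<open>r\<close> behaves like a heap of size 0, 1 or 2, and a sum whose heaps
  include \<open>i\<close> of residue 1 and \<open>j\<close> of residue 2 should represent the monomial \<open>a\<^sup>i b\<^sup>j\<close>. The
  relations \<open>a\<^sup>2 = 1\<close> and \<open>b\<^sup>3 = b\<close> reduce its exponents to a normal form in
  \<open>{0, 1} \<times> {0, 1, 2}\<close>, the invariant \<open>heap_normal_form\<close>. The proof identifies both congruences
  with the kernel of this invariant.

  On the side of the game, the sums with normal form \<open>a\<close> or \<open>b\<^sup>2\<close> satisfy the recursion for
  misere \<open>\<P>\<close>-positions: no move joins two of them, and every other sum with a nonempty heap
  has a move into them (\<open>misere_outcome_iff\<close>). Hence the outcome depends on the normal form
  only. Conversely, adding one of a few small sums tells the six normal forms apart by the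
  outcome, so that \<open>\<equiv>\<close> is the kernel (\<open>misere_equiv_iff\<close>).

  On the side of the presentation, the kernel of the normal form is a congruence satisfying both
  relations, and each monomial is congruent to its normal form, so the generated congruence is
  the kernel as well (\<open>generated_congruence_relations_ab_iff\<close>). Reading the generators as heaps
  of size 1 and 2 therefore induces an isomorphism of the quotients.
\<close>

section \<open>Quotients of commutative monoids\<close>

lemma monoid_congruence_equiv: "monoid_congruence E \<Longrightarrow> equiv UNIV E"
  by (simp add: monoid_congruence_def)

lemma monoid_congruence_add:
  assumes E: "monoid_congruence E" and "(x, x') \<in> E" "(y, y') \<in> E"
  shows "(x + y, x' + y') \<in> E"
proof -
  have "(x + y, x' + y) \<in> E" "(y + x', y' + x') \<in> E"
    using assms by (auto simp: monoid_congruence_def)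
  then show ?thesis
    using monoid_congruence_equiv[OF E] by (auto simp: equiv_def add.commute elim: transE)
qed

lemma mult_quotient_monoid:
  assumes E: "monoid_congruence E"
  shows "E `` {x} \<otimes>\<^bsub>quotient_monoid E\<^esub> E `` {y} = E `` {x + y}"
proof -
  have "congruent2 E E (\<lambda>x y. E `` {x + y})"
    using monoid_congruence_equiv[OF E] monoid_congruence_add[OF E]
    by (auto intro!: congruent2I' equiv_class_eq)
  then show ?thesis
    using UN_equiv_class2[OF monoid_congruence_equiv[OF E] monoid_congruence_equiv[OF E]]
    by (simp add: quotient_monoid_def)
qed

lemma carrier_quotient_monoid: "carrier (quotient_monoid E) = range (\<lambda>x. E `` {x})"
  by (auto simp: quotient_monoid_def quotient_def)

lemma one_quotient_monoid: "\<one>\<^bsub>quotient_monoid E\<^esub> = E `` {0}"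
  by (simp add: quotient_monoid_def)

lemma comm_monoid_quotient_monoid:
  assumes "monoid_congruence E"
  shows "comm_monoid (quotient_monoid E)"
  by (rule comm_monoidI)
    (auto simp: carrier_quotient_monoid one_quotient_monoid mult_quotient_monoid[OF assms] ac_simps)

text \<open>A homomorphism \<open>f\<close> descends to the quotients and becomes injective there, because \<open>E\<close> is the
  preimage of \<open>F\<close>. It becomes surjective as soon as it hits every class of \<open>F\<close>, although \<open>f\<close>
  itself may miss elements: no monomial in heaps of size 1 and 2 is a heap of size 3.\<close>

lemma quotient_monoid_iso:
  assumes E: "monoid_congruence E" and F: "monoid_congruence F"
    and add: "\<And>x y. f (x + y) = f x + f y"
    and kernel: "\<And>x y. (x, y) \<in> E \<longleftrightarrow> (f x, f y) \<in> F"
    and onto: "\<And>y. \<exists>x. (f x, y) \<in> F"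
  shows "\<exists>h \<in> iso (quotient_monoid E) (quotient_monoid F). \<forall>x. h (E `` {x}) = F `` {f x}"
proof -
  have eqE: "E `` {x} = E `` {y} \<longleftrightarrow> (x, y) \<in> E" for x y
    using eq_equiv_class_iff[OF monoid_congruence_equiv[OF E]] by simp
  have eqF: "F `` {x} = F `` {y} \<longleftrightarrow> (x, y) \<in> F" for x y
    using eq_equiv_class_iff[OF monoid_congruence_equiv[OF F]] by simp
  define h where "h C = F `` {f (SOME x. C = E `` {x})}" for C
  have h: "h (E `` {x}) = F `` {f x}" for x
  proof -
    have "E `` {x} = E `` {SOME y. E `` {x} = E `` {y}}"
      by (rule someI) (rule refl)
    then show ?thesis
      unfolding h_def by (metis eqE eqF kernel)
  qed
  have "h \<in> hom (quotient_monoid E) (quotient_monoid F)"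
    by (auto simp: hom_def carrier_quotient_monoid mult_quotient_monoid[OF E]
        mult_quotient_monoid[OF F] h add)
  moreover have "inj_on h (carrier (quotient_monoid E))"
    by (auto simp: inj_on_def carrier_quotient_monoid h eqE eqF kernel)
  moreover have "h ` carrier (quotient_monoid E) = carrier (quotient_monoid F)"
  proof -
    have "F `` {y} \<in> range (\<lambda>x. F `` {f x})" for y
      using onto[of y] eqF by fastforce
    then show ?thesis
      by (auto simp: carrier_quotient_monoid image_image h)
  qed
  ultimately show ?thesis
    using h by (auto simp: iso_def bij_betw_def)
qed

section \<open>Normal forms of monomials\<close>

definition reduced_exponents :: "nat \<Rightarrow> nat \<Rightarrow> nat \<times> nat" where
  "reduced_exponents i j = (i mod 2, if j = 0 then 0 else if odd j then 1 else 2)"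

lemma reduced_exponents_add:
  assumes "reduced_exponents i j = reduced_exponents i' j'"
  shows "reduced_exponents (i + k) (j + l) = reduced_exponents (i' + k) (j' + l)"
proof -
  have "i mod 2 = i' mod 2" "even j = even j'" "j = 0 \<longleftrightarrow> j' = 0"
    using assms by (auto simp: reduced_exponents_def split: if_splits)
  moreover from this have "(i + k) mod 2 = (i' + k) mod 2"
    by (intro mod_add_cong) auto
  ultimately show ?thesis
    by (simp add: reduced_exponents_def)
qed

lemma range_reduced_exponents:
  "reduced_exponents i j \<in> {0, 1} \<times> {0, 1, 2}"
  by (auto simp: reduced_exponents_def)

definition word_normal_form :: "generator multiset \<Rightarrow> nat \<times> nat" where
  "word_normal_form w = reduced_exponents (count w gen_a) (count w gen_b)"

definition monomial :: "nat \<times> nat \<Rightarrow> generator multiset" where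
  "monomial p = replicate_mset (fst p) gen_a + replicate_mset (snd p) gen_b"

lemma monoid_congruence_word_kernel:
  "monoid_congruence {(v, w). word_normal_form v = word_normal_form w}"
  by (auto simp: monoid_congruence_def equiv_def refl_on_def sym_def trans_def
      word_normal_form_def intro: reduced_exponents_add)

lemma word_congruent_normal_form:
  assumes E: "monoid_congruence E" and R: "relations_ab \<subseteq> E"
  shows "(w, monomial (word_normal_form w)) \<in> E"
proof (induction w)
  case empty
  show ?case
    using monoid_congruence_equiv[OF E]
    by (auto simp: word_normal_form_def reduced_exponents_def monomial_def equiv_def refl_on_def)
next
  case (add g w)
  let ?m = "monomial (word_normal_form w)"
  have tr: "(x, z) \<in> E" if "(x, y) \<in> E" "(y, z) \<in> E" for x y z
    using monoid_congruence_equiv[OF E] that by (auto simp: equiv_def elim: transE)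
  have refl: "(x, x) \<in> E" for x
    using monoid_congruence_equiv[OF E] by (auto simp: equiv_def refl_on_def)
  have "(w + {#g#}, ?m + {#g#}) \<in> E"
    by (rule monoid_congruence_add[OF E add.IH refl])
  moreover have "(?m + {#g#}, monomial (word_normal_form (add_mset g w))) \<in> E"
  proof -
    have "({#gen_a, gen_a#}, {#}) \<in> E" "({#gen_b, gen_b, gen_b#}, {#gen_b#}) \<in> E"
      using R by (auto simp: relations_ab_def)
    then have a: "({#gen_a, gen_a#} + x, {#} + x) \<in> E"
      and b: "({#gen_b, gen_b, gen_b#} + x, {#gen_b#} + x) \<in> E" for x
      by (blast intro: monoid_congruence_add[OF E _ refl])+
    obtain i j where ij: "i = count w gen_a" "j = count w gen_b"
      by simp
    have nf: "word_normal_form w = reduced_exponents i j"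
      "word_normal_form (add_mset gen_a w) = reduced_exponents (Suc i) j"
      "word_normal_form (add_mset gen_b w) = reduced_exponents i (Suc j)"
      by (simp_all add: word_normal_form_def ij)
    have two: "replicate_mset 2 gen_b = {#gen_b, gen_b#}"
      by (simp add: numeral_2_eq_2)
    (* Only the products a * a b^j and b * a^i b^2 leave the set of normal forms; each of them
       is rewritten by one of the two relations. *)
    show ?thesis
    proof (cases g)
      case gen_a
      then show ?thesis
        using a[of "replicate_mset (snd (word_normal_form w)) gen_b"] refl
        by (auto simp: nf reduced_exponents_def monomial_def mod2_eq_if)
    next
      case gen_b
      then show ?thesis
        using b[of "replicate_mset (fst (word_normal_form w)) gen_a"] refl
        by (auto simp: nf reduced_exponents_def monomial_def two)
    qed
  qed
  ultimately show ?case
    by (auto intro: tr)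
qed

lemma monoid_congruence_generated: "monoid_congruence (generated_congruence R)"
proof -
  have "equiv UNIV (generated_congruence R)"
    unfolding generated_congruence_def
  proof (intro equivI)
    show "sym (\<Inter>{E. monoid_congruence E \<and> R \<subseteq> E})"
      by (rule symI) (fastforce dest: monoid_congruence_equiv simp: equiv_def elim: symE)
    show "trans (\<Inter>{E. monoid_congruence E \<and> R \<subseteq> E})"
      by (rule transI) (fastforce dest: monoid_congruence_equiv simp: equiv_def elim: transE)
  qed (auto dest!: monoid_congruence_equiv simp: equiv_def refl_on_def)
  then show ?thesis
    by (auto simp: monoid_congruence_def generated_congruence_def)
qed

lemma generated_congruence_relations_ab_iff:
  "(v, w) \<in> generated_congruence relations_ab \<longleftrightarrow> word_normal_form v = word_normal_form w"
proof
  have "relations_ab \<subseteq> {(v, w). word_normal_form v = word_normal_form w}"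
    by (auto simp: relations_ab_def word_normal_form_def reduced_exponents_def)
  then show "word_normal_form v = word_normal_form w"
    if "(v, w) \<in> generated_congruence relations_ab"
    using that monoid_congruence_word_kernel unfolding generated_congruence_def by blast
next
  let ?E = "generated_congruence relations_ab"
  assume eq: "word_normal_form v = word_normal_form w"
  have "relations_ab \<subseteq> ?E"
    by (auto simp: generated_congruence_def)
  then have "(v, monomial (word_normal_form v)) \<in> ?E" "(w, monomial (word_normal_form v)) \<in> ?E"
    using word_congruent_normal_form[OF monoid_congruence_generated] eq by metis+
  then show "(v, w) \<in> ?E"
    using monoid_congruence_equiv[OF monoid_congruence_generated, of relations_ab]
    unfolding equiv_def by (meson symD transD)
qed

section \<open>Misere outcomes\<close>

definition residue_count :: "nat \<Rightarrow> heap_sum \<Rightarrow> nat" where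
  "residue_count k X = size {#r \<in># X. r mod 3 = k#}"

lemma residue_count_empty [simp]: "residue_count k {#} = 0"
  by (simp add: residue_count_def)

lemma residue_count_add_mset [simp]:
  "residue_count k (add_mset r X) = (if r mod 3 = k then 1 else 0) + residue_count k X"
  by (simp add: residue_count_def)

lemma residue_count_union [simp]:
  "residue_count k (X + Y) = residue_count k X + residue_count k Y"
  by (simp add: residue_count_def)

lemma residue_count_pos_iff: "0 < residue_count k X \<longleftrightarrow> (\<exists>r\<in>#X. r mod 3 = k)"
  by (auto simp: residue_count_def size_eq_0_iff_empty filter_mset_eq_conv
      simp flip: neq0_conv)

definition heap_normal_form :: "heap_sum \<Rightarrow> nat \<times> nat" where
  "heap_normal_form X = reduced_exponents (residue_count 1 X) (residue_count 2 X)"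

definition losing :: "heap_sum \<Rightarrow> bool" where
  "losing X \<longleftrightarrow> heap_normal_form X \<in> {(1, 0), (0, 2)}"

text \<open>This is the condition for a loss in misere Nim with heaps of size at most 2, applied to the
  residues modulo 3.\<close>

lemma losing_iff:
  "losing X \<longleftrightarrow> (if residue_count 2 X = 0 then odd (residue_count 1 X)
    else even (residue_count 1 X) \<and> even (residue_count 2 X))"
  by (auto simp: losing_def heap_normal_form_def reduced_exponents_def mod2_eq_if)

lemma residue_after_move:
  fixes r d :: nat
  assumes "d = 1 \<or> d = 2" "d \<le> r"
  shows "(r - d) mod 3 = (r mod 3 + (3 - d)) mod 3"
proof -
  have "(r - d) mod 3 = (r - d + 3) mod 3"
    by simp
  also have "r - d + 3 = r + (3 - d)"
    using assms by auto
  finally show ?thesis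
    by (simp add: mod_add_left_eq)
qed

text \<open>A move changes the residue of one heap, hence the parity of the number of heaps of residue 1
  or of residue 2, so it cannot join two losing sums of the same normal form. Nor can it join
  normal forms \<open>a\<close> and \<open>b\<^sup>2\<close>, whose numbers of heaps of residue 2 differ by at least two.\<close>

lemma follower_of_losing:
  assumes "losing X" "Y \<in> followers X"
  shows "\<not> losing Y"
proof -
  obtain r d Z where X: "X = add_mset r Z" and Y: "Y = add_mset (r - d) Z"
    and d: "d = 1 \<or> d = 2" "d \<le> r"
    using assms(2) by (auto simp: followers_def escalation_set_def)
  have "r mod 3 = 0 \<or> r mod 3 = 1 \<or> r mod 3 = 2"
    by auto
  then show ?thesis
    using d(1) assms(1) residue_after_move[OF d] unfolding losing_iff X Y
    by (elim disjE) (auto dest: odd_pos split: if_splits)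
qed

text \<open>The winning moves are those of misere Nim on the residues: they lower a residue 1 or 2 by
  subtracting at most that residue. The exception is a sum in which all residues are 0, where
  a positive multiple of 3 is reduced to residue 1 and the normal form becomes \<open>a\<close>; this is
  where a nonempty heap is needed.\<close>

lemma winning_has_losing_follower:
  assumes "\<not> losing X" "r0 \<in># X" "r0 \<noteq> 0"
  shows "\<exists>Y\<in>followers X. losing Y"
proof -
  let ?i = "residue_count 1 X" and ?j = "residue_count 2 X"
  have move: "\<exists>Y\<in>followers X. losing Y"
    if "r \<in># X" "d \<in> {1, 2}" "d \<le> r" "\<And>Z. X = add_mset r Z \<Longrightarrow> losing (add_mset (r - d) Z)"
    for r d
  proof -
    obtain Z where "X = add_mset r Z"
      using \<open>r \<in># X\<close> by (metis insert_DiffM)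
    then show ?thesis
      using that unfolding followers_def escalation_set_def by blast
  qed
  consider (no_one_two) "?j = 0" "?i = 0" | (ones) "?j = 0" "?i > 0" | (b_odd) "odd ?j"
    | (b_even) "?j > 0" "even ?j" "odd ?i"
    using assms(1) by (auto simp: losing_iff split: if_splits)
  then show ?thesis
  proof cases
    case no_one_two
    have "r0 mod 3 \<noteq> 1" "r0 mod 3 \<noteq> 2"
      using no_one_two residue_count_pos_iff[of 1 X] residue_count_pos_iff[of 2 X] assms(2)
      by auto
    moreover from this have "r0 mod 3 = 0"
      by linarith
    moreover have "r0 \<noteq> 1"
      using \<open>r0 mod 3 \<noteq> 1\<close> by auto
    ultimately have "2 \<le> r0" "(r0 - 2) mod 3 = 1" "r0 mod 3 = 0"
      using assms(3) residue_after_move[of 2 r0] by auto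
    then show ?thesis
      using no_one_two by (intro move[OF assms(2), of 2]) (auto simp: losing_iff)
  next
    case ones
    then obtain r where r: "r \<in># X" "r mod 3 = 1"
      using residue_count_pos_iff by blast
    then have "1 \<le> r" "(r - 1) mod 3 = 0"
      using mod_less_eq_dividend[of r 3] residue_after_move[of 1 r] by auto
    then show ?thesis
      using ones r assms(1) by (intro move[OF r(1), of 1]) (auto simp: losing_iff)
  next
    case b_odd
    then obtain r where r: "r \<in># X" "r mod 3 = 2"
      using residue_count_pos_iff odd_pos by blast
    then have r': "2 \<le> r" "(r - 1) mod 3 = 1" "(r - 2) mod 3 = 0"
      using mod_less_eq_dividend[of r 3] residue_after_move[of 1 r] residue_after_move[of 2 r]
      by auto
    (* Of the moves to residues 1 and 0, the one to take gives an odd number of heaps of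
       residue 1 if no other heap of residue 2 is left, and an even number otherwise. *)
    show ?thesis
    proof (cases "even ?i = (?j = 1)")
      case True
      then show ?thesis
        using b_odd r r' by (intro move[OF r(1), of 1]) (auto simp: losing_iff)
    next
      case False
      then show ?thesis
        using b_odd r r' by (intro move[OF r(1), of 2]) (auto simp: losing_iff)
    qed
  next
    case b_even
    then obtain r where r: "r \<in># X" "r mod 3 = 1"
      using residue_count_pos_iff odd_pos by blast
    then have "1 \<le> r" "(r - 1) mod 3 = 0"
      using mod_less_eq_dividend[of r 3] residue_after_move[of 1 r] by auto
    then show ?thesis
      using b_even r by (intro move[OF r(1), of 1]) (auto simp: losing_iff)
  qed
qed

lemma misere_outcome_iff: "misere_outcome X = P_position \<longleftrightarrow> losing X"
proof (induction X rule: measure_induct_rule[of sum_mset])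
  case (less X)
  show ?case
  proof (cases "\<forall>r\<in>#X. r = 0")
    case True
    then have "residue_count 1 X = 0" "residue_count 2 X = 0"
      using residue_count_pos_iff[of 1 X] residue_count_pos_iff[of 2 X] by force+
    then show ?thesis
      using True by (simp add: misere_outcome.simps[of X] losing_iff)
  next
    case False
    have "misere_outcome Y = N_position \<longleftrightarrow> \<not> losing Y" if "Y \<in> followers X" for Y
      using less[OF followers_sum_mset_less[OF that]] by (cases "misere_outcome Y") auto
    then show ?thesis
      using False follower_of_losing[of X] winning_has_losing_follower[of X]
      by (auto simp: misere_outcome.simps[of X])
  qed
qed

section \<open>The misere quotient\<close>

lemma misere_equiv_iff_losing: "(X, Y) \<in> misere_equiv \<longleftrightarrow> (\<forall>Z. losing (X + Z) \<longleftrightarrow> losing (Y + Z))"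
proof -
  have "misere_outcome V = misere_outcome W \<longleftrightarrow> (losing V \<longleftrightarrow> losing W)" for V W
    unfolding misere_outcome_iff[symmetric]
    by (cases "misere_outcome V"; cases "misere_outcome W") auto
  then show ?thesis
    by (simp add: misere_equiv_def)
qed

text \<open>The normal forms are told apart by which of the summands \<open>1\<close>, \<open>a\<close>, \<open>b\<close>, \<open>b\<^sup>2\<close> turn them into
  a losing sum: these are \<open>{a, b\<^sup>2}\<close> for \<open>1\<close>, \<open>{1}\<close> for \<open>a\<close>, \<open>{b}\<close> for \<open>b\<close>, none for \<open>ab\<close>,
  \<open>{1, b\<^sup>2}\<close> for \<open>b\<^sup>2\<close> and \<open>{a}\<close> for \<open>ab\<^sup>2\<close>.\<close>

lemma misere_equiv_iff:
  "(X, Y) \<in> misere_equiv \<longleftrightarrow> heap_normal_form X = heap_normal_form Y"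
proof
  assume "(X, Y) \<in> misere_equiv"
  then have "losing (X + Z) \<longleftrightarrow> losing (Y + Z)" for Z
    by (simp add: misere_equiv_iff_losing)
  from this[of "{#}"] this[of "{#1#}"] this[of "{#2#}"] this[of "{#2, 2#}"]
  show "heap_normal_form X = heap_normal_form Y"
    by (auto simp: losing_iff heap_normal_form_def reduced_exponents_def mod2_eq_if split: if_splits)
next
  assume "heap_normal_form X = heap_normal_form Y"
  then have "heap_normal_form (X + Z) = heap_normal_form (Y + Z)" for Z
    unfolding heap_normal_form_def residue_count_union by (rule reduced_exponents_add)
  then show "(X, Y) \<in> misere_equiv"
    by (simp add: misere_equiv_iff_losing losing_def)
qed

lemma misere_class_eq_iff:
  "misere_class X = misere_class Y \<longleftrightarrow> heap_normal_form X = heap_normal_form Y"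
  unfolding misere_class_def misere_equiv_iff[symmetric]
  using eq_equiv_class_iff[OF monoid_congruence_equiv[OF monoid_congruence_misere_equiv]] by simp

lemma carrier_misere_quotient: "carrier misere_quotient = range misere_class"
  by (simp add: misere_quotient_def carrier_quotient_monoid misere_class_def[abs_def])

lemma mult_misere_class:
  "misere_class X \<otimes>\<^bsub>misere_quotient\<^esub> misere_class Y = misere_class (X + Y)"
  by (simp add: misere_quotient_def misere_class_def
      mult_quotient_monoid[OF monoid_congruence_misere_equiv])

lemma one_misere_quotient: "\<one>\<^bsub>misere_quotient\<^esub> = misere_class {#}"
  by (simp add: misere_quotient_def one_quotient_monoid misere_class_def)

lemma square_misere_class:
  "misere_class X [^]\<^bsub>misere_quotient\<^esub> (2::nat) = misere_class (X + X)"
  by (simp add: numeral_2_eq_2 nat_pow_def one_misere_quotient mult_misere_class)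

lemma carrier_misere_quotient_representatives:
  "carrier misere_quotient = misere_class `
     {{#}, {#1#}, {#2#}, {#2, 1#}, {#2, 2#}, {#2, 2, 1#}}" (is "_ = misere_class ` ?S")
proof -
  have "misere_class X \<in> misere_class ` ?S" for X
    using range_reduced_exponents[of "residue_count 1 X" "residue_count 2 X"]
    by (auto simp: misere_class_eq_iff heap_normal_form_def reduced_exponents_def)
  then show ?thesis
    unfolding carrier_misere_quotient by blast
qed

lemma order_misere_quotient: "order misere_quotient = 6"
  unfolding order_def carrier_misere_quotient_representatives
  by (simp add: misere_class_eq_iff heap_normal_form_def reduced_exponents_def)

lemma loss_set_representatives: "loss_set = {misere_class {#1#}, misere_class {#2, 2#}}"
proof -
  have nf: "heap_normal_form {#1#} = (1, 0)" "heap_normal_form {#2, 2#} = (0, 2)"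
    by (simp_all add: heap_normal_form_def reduced_exponents_def)
  then have "losing {#1#}" "losing {#2, 2#}"
    by (simp_all add: losing_def)
  moreover have "misere_class X \<in> {misere_class {#1#}, misere_class {#2, 2#}}" if "losing X" for X
    using that nf by (auto simp: losing_def misere_class_eq_iff)
  ultimately show ?thesis
    unfolding loss_set_def misere_outcome_iff by blast
qed

fun generator_heap :: "generator \<Rightarrow> nat" where
  "generator_heap gen_a = 1"
| "generator_heap gen_b = 2"

lemma heap_normal_form_word:
  "heap_normal_form (image_mset generator_heap w) = word_normal_form w"
proof -
  have "residue_count 1 (image_mset generator_heap w) = count w gen_a \<and>
      residue_count 2 (image_mset generator_heap w) = count w gen_b"
  proof (induction w)
    case (add g w)
    then show ?case
      by (cases g) auto
  qed simp
  then show ?thesis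
    by (simp add: heap_normal_form_def word_normal_form_def)
qed

lemma presented_iso_misere_quotient:
  "\<exists>h \<in> iso (presented_comm_monoid relations_ab) misere_quotient.
     \<forall>g. h (presented_generator relations_ab g) = misere_class {#generator_heap g#}"
proof -
  have onto: "\<exists>w. word_normal_form w = heap_normal_form X" for X
  proof
    show "word_normal_form (monomial (residue_count 1 X, residue_count 2 X)) = heap_normal_form X"
      by (simp add: monomial_def word_normal_form_def heap_normal_form_def)
  qed
  have "\<exists>h \<in> iso (quotient_monoid (generated_congruence relations_ab))
        (quotient_monoid misere_equiv).
      \<forall>w. h (generated_congruence relations_ab `` {w}) =
        misere_equiv `` {image_mset generator_heap w}"
    by (rule quotient_monoid_iso[OF monoid_congruence_generated monoid_congruence_misere_equiv])
      (simp_all add: onto generated_congruence_relations_ab_iff misere_equiv_iff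
        heap_normal_form_word)
  then show ?thesis
    unfolding presented_comm_monoid_def presented_generator_def misere_quotient_def
      misere_class_def by (metis image_mset_single)
qed

theorem theorem6p3:
  fixes Q :: "heap_sum set monoid" (structure)
    and a b :: "heap_sum set"
  assumes "Q = misere_quotient"
    and "a = misere_class {#1#}"
    and "b = misere_class {#2#}"
  shows "comm_monoid Q \<and>
    (\<exists>h \<in> iso (presented_comm_monoid relations_ab) Q.
       h (presented_generator relations_ab gen_a) = a \<and>
       h (presented_generator relations_ab gen_b) = b) \<and>
    order Q = 6 \<and>
    carrier Q = {\<one>, a, b, a \<otimes> b, b [^] (2::nat), a \<otimes> b [^] (2::nat)} \<and>
    loss_set = {a, b [^] (2::nat)}"
proof (intro conjI)
  show "comm_monoid Q"
    unfolding assms(1) misere_quotient_def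
    by (rule comm_monoid_quotient_monoid[OF monoid_congruence_misere_equiv])
  show "\<exists>h \<in> iso (presented_comm_monoid relations_ab) Q.
      h (presented_generator relations_ab gen_a) = a \<and>
      h (presented_generator relations_ab gen_b) = b"
    using presented_iso_misere_quotient unfolding assms
    by (metis generator_heap.simps)
  show "order Q = 6"
    unfolding assms(1) by (rule order_misere_quotient)
  show "carrier Q = {\<one>, a, b, a \<otimes> b, b [^] (2::nat), a \<otimes> b [^] (2::nat)}"
    unfolding assms carrier_misere_quotient_representatives
    by (simp add: one_misere_quotient square_misere_class mult_misere_class)
  show "loss_set = {a, b [^] (2::nat)}"
    unfolding assms loss_set_representatives by (simp add: square_misere_class)
qed

end
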